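(* Let $\lambda>0$, $m\in\{0,1,2,\ldots\}$, and let $Z_\lambda\sim\mathcal{P}(\lambda)$ be Poisson distributed with parameter $\lambda$. Then for all $F:\mathbf{R}\to\mathbf{R}$ with $E|C_\lambda^m(Z_\lambda)F(Z_\lambda)|<\infty$, $$E\,C_\lambda^m(Z_\lambda)F(Z_\lambda)=\lambda^m\,E\,\Delta^mF(Z_\lambda);$$ that is, for all $m=0,1,\ldots$ the Poisson distribution $\mathcal{P}(\lambda)$ is a fixed point, $(Z_\lambda)_\lambda^{(m)}=Z_\lambda$ in distribution, of the discrete transformation of order $m$ induced by the Charlier polynomial $C_\lambda^m$.
   Context: $\mathcal{P}(\lambda)$ has mass function $e^{-\lambda}\lambda^k/k!$, $k=0,1,\ldots$. The Charlier polynomials are defined by $$e^{-\lambda t}(1+t)^x=\sum_{m=0}^\infty C_\lambda^m(x)\frac{t^m}{m!},\quad\text{equivalently}\quad C_\lambda^m(x)=\sum_{k=0}^m\binom mk(x)_k(-\lambda)^{m-k},$$ where $(x)_k=x(x-1)\cdots(x-k+1)$. $\Delta f(x)=f(x+1)-f(x)$, and $\Delta^m$ is its $m$-fold iterate. For an integer valued random variable $X$ and function $P$, the discrete $X$-$P$ biased distribution of order $m$ is the distribution of a variable $X^{(m)}$ such that, for a constant $\alpha>0$, $E\,P(X)F(X)=\alpha\,E\,\Delta^mF(X^{(m)})$ for all $F:\mathbf{R}\to\mathbf{R}$ with $E|P(X)F(X)|<\infty$; for $P=C_\lambda^m$ it is denoted $X_\lambda^{(m)}$. *)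

theory Defs
  imports "HOL-Probability.Probability"
begin

definition falling_fact :: "real \<Rightarrow> nat \<Rightarrow> real" where
  "falling_fact x k = (\<Prod>i<k. x - real i)"

definition charlier :: "real \<Rightarrow> nat \<Rightarrow> real \<Rightarrow> real" where
  "charlier lam m x = (\<Sum>k\<le>m. real (m choose k) * falling_fact x k * (- lam) ^ (m - k))"

text \<open>The equivalent description by the exponential generating function
  \<open>exp (- lam * t) * (1 + t) powr x\<close>, read as a formal power series in \<open>t\<close>.\<close>

lemma charlier_generating_function:
  "charlier lam m x = fact m * fps_nth (fps_exp (- lam) * fps_binomial x) m"
proof -
  have "fact m * fps_nth (fps_exp (- lam) * fps_binomial x) m
      = (\<Sum>k\<le>m. fact m * ((x gchoose k) * ((- lam) ^ (m - k) / fact (m - k))))"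
    by (subst mult.commute[of "fps_exp _"])
       (simp add: fps_mult_nth sum_distrib_left atLeast0AtMost)
  also have "\<dots> = charlier lam m x"
    unfolding charlier_def
    by (rule sum.cong)
       (auto simp: gbinomial_prod_rev falling_fact_def binomial_fact atLeast0LessThan
             mult_ac)
  finally show ?thesis ..
qed

definition fwd_diff :: "(real \<Rightarrow> real) \<Rightarrow> real \<Rightarrow> real" where
  "fwd_diff f x = f (x + 1) - f x"

text \<open>\<open>discrete_biased M X P m N Y\<close>: the real random variable \<open>Y\<close> on the probability space \<open>N\<close>
  has the discrete \<open>X\<close>-\<open>P\<close> biased distribution of order \<open>m\<close>, for the integer valued random
  variable \<open>X\<close> on \<open>M\<close>. The test functions \<open>F\<close> are arbitrary; integrability of the
  difference is demanded since the Bochner integral of a non-integrable function is \<open>0\<close>.\<close>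

definition discrete_biased ::
    "'a measure \<Rightarrow> ('a \<Rightarrow> real) \<Rightarrow> (real \<Rightarrow> real) \<Rightarrow> nat \<Rightarrow> 'b measure \<Rightarrow> ('b \<Rightarrow> real) \<Rightarrow> bool" where
  "discrete_biased M X P m N Y \<longleftrightarrow>
     prob_space M \<and> X \<in> borel_measurable M \<and> (\<forall>\<omega>\<in>space M. X \<omega> \<in> \<int>) \<and>
     prob_space N \<and> Y \<in> borel_measurable N \<and>
     (\<exists>\<alpha>>0. \<forall>F :: real \<Rightarrow> real. integrable M (\<lambda>\<omega>. P (X \<omega>) * F (X \<omega>)) \<longrightarrow>
        integrable N (\<lambda>\<omega>. (fwd_diff ^^ m) F (Y \<omega>)) \<and>
        (\<integral>\<omega>. P (X \<omega>) * F (X \<omega>) \<partial>M) = \<alpha> * (\<integral>\<omega>. (fwd_diff ^^ m) F (Y \<omega>) \<partial>N))"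

end

theory Submission
  imports Defs
begin

text \<open>
  For \<open>Z\<close> Poisson with parameter \<open>lam\<close>, the recursion \<open>n * p n = lam * p (n - 1)\<close> of the weights gives
  \<open>E (Z)_k F(Z) = lam^k E F(Z + k)\<close> (lemma \<open>poisson_falling_fact\<close>). Since the Charlier polynomial is a
  combination of falling factorials with coefficients \<open>(m choose k) (- lam)^(m - k)\<close>, linearity turns
  \<open>E C(Z) F(Z)\<close> into \<open>lam^m\<close> times the alternating binomial sum of the \<open>E F(Z + k)\<close>, which is the expected
  \<open>m\<close>-th difference (lemma \<open>poisson_charlier\<close>). The delicate point is that only \<open>C(Z) F(Z)\<close> is assumed
  integrable, whereas linearity needs every \<open>(Z)_k F(Z)\<close> with \<open>k \<le> m\<close> to be so. This holds
  because \<open>C\<close> is monic of degree \<open>m\<close>, hence dominates these falling factorials at all but finitely many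
  natural numbers (lemma \<open>falling_fact_le_charlier\<close>).

  For uniqueness, let \<open>Y\<close> be any variable with the biased distribution, with constant \<open>\<alpha>\<close>. Every
  function on the line is an \<open>m\<close>-th difference, and the indicator of a Borel set \<open>A\<close> is the \<open>m\<close>-th
  difference of some \<open>F\<close> with \<open>\<bar>F(n)\<bar> \<le> n^m\<close> on the natural numbers
  (lemma \<open>iterated_antidifference_exists\<close>), which makes \<open>F\<close> an admissible test function. Comparing the
  biasing identities of \<open>Y\<close> and \<open>Z\<close> for this \<open>F\<close> yields \<open>\<alpha> P(Y \<in> A) = lam^m P(Z \<in> A)\<close>; taking
  the whole line for \<open>A\<close> gives \<open>\<alpha> = lam^m\<close>, and so the two laws agree.
\<close>

section \<open>Expansion of iterated differences\<close>

text \<open>Pascal's rule under a weighted sum: it carries the induction step of the expansion below.\<close>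

lemma sum_choose_Suc:
  fixes a :: "nat \<Rightarrow> real"
  shows "(\<Sum>k\<le>Suc m. real (Suc m choose k) * a k) = (\<Sum>k\<le>m. real (m choose k) * (a k + a (Suc k)))"
proof -
  have "(\<Sum>k\<le>Suc m. real (Suc m choose k) * a k)
      = a 0 + (\<Sum>k\<le>m. real (m choose k) * a (Suc k)) + (\<Sum>k\<le>m. real (m choose Suc k) * a (Suc k))"
    by (subst sum.atMost_Suc_shift) (simp add: distrib_right sum.distrib)
  moreover have "(\<Sum>k\<le>Suc m. real (m choose k) * a k) = a 0 + (\<Sum>k\<le>m. real (m choose Suc k) * a (Suc k))"
    by (subst sum.atMost_Suc_shift) simp
  moreover have "(\<Sum>k\<le>Suc m. real (m choose k) * a k) = (\<Sum>k\<le>m. real (m choose k) * a k)"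
    by simp
  ultimately show ?thesis
    by (simp add: distrib_left sum.distrib)
qed

lemma fwd_diff_funpow:
  "(fwd_diff ^^ m) F x = (\<Sum>k\<le>m. real (m choose k) * ((- 1) ^ (m - k) * F (x + real k)))"
proof (induction m arbitrary: x)
  case 0
  then show ?case by simp
next
  case (Suc m)
  have "(fwd_diff ^^ Suc m) F x = (fwd_diff ^^ m) F (x + 1) - (fwd_diff ^^ m) F x"
    by (simp add: fwd_diff_def)
  also have "\<dots> = (\<Sum>k\<le>m. real (m choose k) *
       ((- 1) ^ (Suc m - k) * F (x + real k) + (- 1) ^ (Suc m - Suc k) * F (x + real (Suc k))))"
    unfolding Suc.IH sum_subtractf[symmetric]
    by (intro sum.cong refl) (auto simp: Suc_diff_le algebra_simps)
  also have "\<dots> = (\<Sum>k\<le>Suc m. real (Suc m choose k) * ((- 1) ^ (Suc m - k) * F (x + real k)))"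
    by (rule sum_choose_Suc[symmetric])
  finally show ?case .
qed

section \<open>Falling factorials and Charlier polynomials at natural numbers\<close>

lemma falling_fact_eq_0: "n < k \<Longrightarrow> falling_fact (real n) k = 0"
  unfolding falling_fact_def by (rule prod_zero) auto

lemma falling_fact_nonneg: "falling_fact (real n) k \<ge> 0"
proof (cases "n < k")
  case False
  then show ?thesis unfolding falling_fact_def by (intro prod_nonneg) auto
qed (simp add: falling_fact_eq_0)

lemma falling_fact_le_power: "falling_fact (real n) k \<le> real n ^ k"
proof (cases "n < k")
  case False
  have "falling_fact (real n) k \<le> (\<Prod>i<k. real n)"
    unfolding falling_fact_def using False by (intro prod_mono) auto
  then show ?thesis by simp
qed (simp add: falling_fact_eq_0)

lemma falling_fact_add: "falling_fact (real (n + k)) k * fact n = fact (n + k)"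
proof (induction k)
  case 0
  then show ?case by (simp add: falling_fact_def)
next
  case (Suc k)
  have "falling_fact (real (n + Suc k)) (Suc k) = real (n + Suc k) * falling_fact (real (n + k)) k"
    unfolding falling_fact_def by (subst prod.lessThan_Suc_shift) (simp add: algebra_simps)
  then have "falling_fact (real (n + Suc k)) (Suc k) * fact n
      = real (n + Suc k) * (falling_fact (real (n + k)) k * fact n)"
    by simp
  then show ?case unfolding Suc.IH by simp
qed

text \<open>Raising the order of a falling factorial from \<open>k\<close> to \<open>m\<close> multiplies it by factors of which the
  smallest is \<open>n - m + 1\<close>. This gap makes the term of highest order dominate a Charlier polynomial.\<close>

lemma falling_fact_mult_le:
  assumes "k < m" "m \<le> n"
  shows "falling_fact (real n) k * (real n - real m + 1) \<le> falling_fact (real n) m"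
  using assms
proof (induction m)
  case (Suc m)
  have step: "falling_fact (real n) (Suc m) = falling_fact (real n) m * (real n - real m)"
    by (simp add: falling_fact_def)
  show ?case
  proof (cases "k = m")
    case True
    then show ?thesis by (simp add: step)
  next
    case False
    have "falling_fact (real n) k * (real n - real m) \<le> falling_fact (real n) k * (real n - real m + 1)"
      by (intro mult_left_mono falling_fact_nonneg) simp
    also have "\<dots> \<le> falling_fact (real n) m"
      using Suc False by simp
    also have "\<dots> \<le> falling_fact (real n) m * (real n - real m)"
      using mult_left_mono[of 1 "real n - real m" "falling_fact (real n) m"] Suc.prems falling_fact_nonneg
      by auto
    finally show ?thesis by (simp add: step)
  qed
qed simp

text \<open>The Charlier polynomial is \<open>falling_fact x m\<close> plus lower falling factorials with fixed
  coefficients. The lower ones are smaller by a factor of order \<open>n\<close>, so for large \<open>n\<close> they take away at most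
  half of the leading term. A restriction to large \<open>n\<close> is unavoidable, because the polynomial may have
  zeros among the natural numbers.\<close>

lemma falling_fact_le_charlier:
  fixes lam :: real
  obtains N where "\<And>n j. n \<ge> N \<Longrightarrow> j \<le> m \<Longrightarrow> falling_fact (real n) j \<le> 2 * \<bar>charlier lam m (real n)\<bar>"
proof -
  define c where "c k = real (m choose k) * (- lam) ^ (m - k)" for k
  \<comment> \<open>The lower order terms sum to at most \<open>K / (n - m + 1)\<close> times the leading one, which is at most
      half of it as soon as \<open>n - m \<ge> 2 * K\<close>.\<close>
  define K where "K = (\<Sum>k<m. \<bar>c k\<bar>)"
  obtain N0 :: nat where N0: "real N0 \<ge> 2 * K"
    using real_arch_simple by blast
  show ?thesis
  proof (rule that[of "m + N0"])
    fix n j assume n: "n \<ge> m + N0" and j: "j \<le> m"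
    let ?f = "falling_fact (real n)"
    have pos: "real n - real m + 1 > 0" using n by simp
    have eq: "charlier lam m (real n) = ?f m + (\<Sum>k<m. c k * ?f k)"
      unfolding charlier_def lessThan_Suc_atMost[symmetric] c_def by (simp add: mult_ac)
    have "\<bar>\<Sum>k<m. c k * ?f k\<bar> * (real n - real m + 1)
        \<le> (\<Sum>k<m. \<bar>c k\<bar> * ?f k) * (real n - real m + 1)"
      using pos by (intro mult_right_mono order_trans[OF sum_abs])
        (auto simp: abs_mult falling_fact_nonneg)
    also have "\<dots> = (\<Sum>k<m. \<bar>c k\<bar> * (?f k * (real n - real m + 1)))"
      by (simp add: sum_distrib_right mult.assoc)
    also have "\<dots> \<le> (\<Sum>k<m. \<bar>c k\<bar> * ?f m)"
      using n by (intro sum_mono mult_left_mono falling_fact_mult_le) auto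
    also have "\<dots> = K * ?f m"
      by (simp add: K_def sum_distrib_right)
    also have "\<dots> \<le> (real n - real m + 1) / 2 * ?f m"
      using N0 n by (intro mult_right_mono falling_fact_nonneg) auto
    also have "\<dots> = ?f m / 2 * (real n - real m + 1)"
      by simp
    finally have "\<bar>\<Sum>k<m. c k * ?f k\<bar> \<le> ?f m / 2"
      using pos by (rule mult_right_le_imp_le)
    then have "?f m \<le> 2 * \<bar>charlier lam m (real n)\<bar>"
      using eq by linarith
    moreover have "?f j \<le> ?f m"
    proof (cases "j = m")
      case False
      have "?f j * 1 \<le> ?f j * (real n - real m + 1)"
        using n by (intro mult_left_mono falling_fact_nonneg) auto
      also have "\<dots> \<le> ?f m" using n j False by (intro falling_fact_mult_le) auto
      finally show ?thesis by simp
    qed simp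
    ultimately show "?f j \<le> 2 * \<bar>charlier lam m (real n)\<bar>" by linarith
  qed
qed

text \<open>Replacing falling factorials by powers and dropping signs turns the defining sum into a
  binomial expansion.\<close>

lemma abs_charlier_le:
  assumes "lam > 0"
  shows "\<bar>charlier lam m (real n)\<bar> \<le> (real n + lam) ^ m"
proof -
  have "\<bar>charlier lam m (real n)\<bar> \<le> (\<Sum>k\<le>m. real (m choose k) * real n ^ k * lam ^ (m - k))"
    unfolding charlier_def using assms
    by (intro order_trans[OF sum_abs] sum_mono)
       (auto simp: abs_mult power_abs falling_fact_nonneg
             intro!: mult_mono falling_fact_le_power)
  then show ?thesis by (simp add: binomial_ring)
qed

section \<open>The Poisson distribution\<close>

lemma integrable_pmf_nat:
  fixes p :: "nat pmf" and f :: "nat \<Rightarrow> real"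
  shows "integrable (measure_pmf p) f \<longleftrightarrow> summable (\<lambda>n. \<bar>pmf p n * f n\<bar>)"
  by (subst measure_pmf_eq_density)
     (simp add: integrable_density integrable_count_space_nat_iff)

lemma integral_pmf_nat:
  fixes p :: "nat pmf" and f :: "nat \<Rightarrow> real"
  assumes "integrable (measure_pmf p) f"
  shows "integral\<^sup>L (measure_pmf p) f = (\<Sum>n. pmf p n * f n)"
  using assms
  by (subst measure_pmf_eq_density, subst integral_density)
     (auto simp: integrable_pmf_nat integrable_count_space_nat_iff integral_count_space_nat)

text \<open>The Poisson weights satisfy \<open>n * p n = lam * p (n - 1)\<close>; this is the \<open>k\<close>-fold iterate.\<close>

lemma pmf_poisson_falling_fact:
  assumes "lam > 0"
  shows "pmf (poisson_pmf lam) (n + k) * falling_fact (real (n + k)) k = lam ^ k * pmf (poisson_pmf lam) n"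
proof -
  have "falling_fact (real (n + k)) k = fact (n + k) / fact n"
    using falling_fact_add[of n k] by (simp add: field_simps)
  then show ?thesis
    using assms by (simp add: power_add)
qed

text \<open>The identity \<open>E (Z)_k f(Z) = lam^k E f(Z + k)\<close>, the analogue of integration by parts for the Poisson
  distribution: shift the summation index by \<open>k\<close>. Nothing is lost at the start of the series, because
  the falling factorial vanishes at \<open>0, \<dots>, k - 1\<close>.\<close>

lemma poisson_falling_fact:
  fixes f :: "nat \<Rightarrow> real"
  assumes lam: "lam > 0" and int: "integrable (measure_pmf (poisson_pmf lam)) (\<lambda>n. falling_fact (real n) k * f n)"
  shows "integrable (measure_pmf (poisson_pmf lam)) (\<lambda>n. f (n + k))"
    and "(\<integral>n. falling_fact (real n) k * f n \<partial>measure_pmf (poisson_pmf lam))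
       = lam ^ k * (\<integral>n. f (n + k) \<partial>measure_pmf (poisson_pmf lam))"
proof -
  let ?p = "poisson_pmf lam"
  define h where "h n = pmf ?p n * (falling_fact (real n) k * f n)" for n
  have h: "h (n + k) = lam ^ k * (pmf ?p n * f (n + k))" for n
    using pmf_poisson_falling_fact[OF lam, of n k] unfolding h_def by (metis mult.assoc)
  have sh: "summable (\<lambda>n. \<bar>h n\<bar>)"
    using int by (simp add: integrable_pmf_nat h_def)
  then have "summable (\<lambda>n. \<bar>h (n + k)\<bar>)"
    using summable_iff_shift[of "\<lambda>n. \<bar>h n\<bar>" k] by simp
  then have "summable (\<lambda>n. \<bar>pmf ?p n * f (n + k)\<bar>)"
    using lam unfolding h abs_mult[of "lam ^ k"] by (subst (asm) summable_cmult_iff) auto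
  then show int': "integrable (measure_pmf ?p) (\<lambda>n. f (n + k))"
    by (simp add: integrable_pmf_nat)
  then have s: "summable (\<lambda>n. pmf ?p n * f (n + k))"
    unfolding integrable_pmf_nat by (rule summable_rabs_cancel)
  have "(\<integral>n. falling_fact (real n) k * f n \<partial>measure_pmf ?p) = (\<Sum>n. h n)"
    using int by (simp add: integral_pmf_nat h_def)
  also have "\<dots> = (\<Sum>n. h (n + k)) + (\<Sum>n<k. h n)"
    by (rule suminf_split_initial_segment[OF summable_rabs_cancel[OF sh]])
  also have "(\<Sum>n<k. h n) = 0"
    by (intro sum.neutral) (auto simp: h_def falling_fact_eq_0)
  also have "(\<Sum>n. h (n + k)) = lam ^ k * (\<Sum>n. pmf ?p n * f (n + k))"
    unfolding h using s by (rule suminf_mult)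
  finally show "(\<integral>n. falling_fact (real n) k * f n \<partial>measure_pmf ?p)
       = lam ^ k * (\<integral>n. f (n + k) \<partial>measure_pmf ?p)"
    using int' by (simp add: integral_pmf_nat)
qed

text \<open>This is what allows the expectation of the Charlier polynomial to be taken term by term. On the
  natural numbers the comparison fails only at finitely many points, and these do not affect
  summability.\<close>

lemma integrable_falling_fact_if_charlier:
  fixes f :: "nat \<Rightarrow> real" and p :: "nat pmf"
  assumes int: "integrable (measure_pmf p) (\<lambda>n. charlier lam m (real n) * f n)"
    and j: "j \<le> m"
  shows "integrable (measure_pmf p) (\<lambda>n. falling_fact (real n) j * f n)"
proof -
  obtain N where N: "\<And>n j. n \<ge> N \<Longrightarrow> j \<le> m \<Longrightarrow> falling_fact (real n) j \<le> 2 * \<bar>charlier lam m (real n)\<bar>"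
    using falling_fact_le_charlier[of m lam] by blast
  have s: "summable (\<lambda>n. 2 * \<bar>pmf p n * (charlier lam m (real n) * f n)\<bar>)"
    using int unfolding integrable_pmf_nat by (rule summable_mult)
  have "\<bar>pmf p n * (falling_fact (real n) j * f n)\<bar> \<le>
      2 * \<bar>pmf p n * (charlier lam m (real n) * f n)\<bar>" if "n \<ge> N" for n
    using mult_right_mono[OF N[OF that j], of "pmf p n * \<bar>f n\<bar>"]
    by (simp add: abs_mult falling_fact_nonneg mult_ac)
  then show ?thesis
    unfolding integrable_pmf_nat
    by (intro summable_comparison_test'[OF s, of N]) auto
qed

lemma poisson_charlier:
  fixes F :: "real \<Rightarrow> real"
  assumes lam: "lam > 0"
    and int: "integrable (measure_pmf (poisson_pmf lam)) (\<lambda>n. charlier lam m (real n) * F (real n))"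
  shows "integrable (measure_pmf (poisson_pmf lam)) (\<lambda>n. (fwd_diff ^^ m) F (real n))"
    and "(\<integral>n. charlier lam m (real n) * F (real n) \<partial>measure_pmf (poisson_pmf lam))
       = lam ^ m * (\<integral>n. (fwd_diff ^^ m) F (real n) \<partial>measure_pmf (poisson_pmf lam))"
proof -
  let ?p = "measure_pmf (poisson_pmf lam)"
  have i1: "integrable ?p (\<lambda>n. falling_fact (real n) k * F (real n))" if "k \<le> m" for k
    using int that by (rule integrable_falling_fact_if_charlier)
  note i2 = poisson_falling_fact[OF lam i1]
  have i3: "integrable ?p (\<lambda>n. F (real n + real k))" if "k \<le> m" for k
    using i2(1)[OF that] by simp
  show "integrable ?p (\<lambda>n. (fwd_diff ^^ m) F (real n))"
    unfolding fwd_diff_funpow using i3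
    by (intro Bochner_Integration.integrable_sum integrable_mult_right) auto
  have "(\<integral>n. charlier lam m (real n) * F (real n) \<partial>?p)
      = (\<integral>n. (\<Sum>k\<le>m. real (m choose k) * (- lam) ^ (m - k) * (falling_fact (real n) k * F (real n))) \<partial>?p)"
    by (simp add: charlier_def sum_distrib_right sum_distrib_left mult_ac)
  also have "\<dots> = (\<Sum>k\<le>m. real (m choose k) * (- lam) ^ (m - k) * (\<integral>n. falling_fact (real n) k * F (real n) \<partial>?p))"
    using i1 by (subst Bochner_Integration.integral_sum) auto
  also have "\<dots> = (\<Sum>k\<le>m. lam ^ m * (real (m choose k) * ((- 1) ^ (m - k) * (\<integral>n. F (real n + real k) \<partial>?p))))"
  proof (intro sum.cong refl)
    fix k assume "k \<in> {..m}"
    then have k: "k \<le> m" by simp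
    have "(- lam) ^ (m - k) * lam ^ k = (- 1) ^ (m - k) * lam ^ m"
      using k by (subst power_minus) (simp add: power_add[symmetric])
    then show "real (m choose k) * (- lam) ^ (m - k) * (\<integral>n. falling_fact (real n) k * F (real n) \<partial>?p)
      = lam ^ m * (real (m choose k) * ((- 1) ^ (m - k) * (\<integral>n. F (real n + real k) \<partial>?p)))"
      using i2(2)[OF k] by (simp add: mult_ac)
  qed
  also have "\<dots> = lam ^ m * (\<integral>n. (fwd_diff ^^ m) F (real n) \<partial>?p)"
    unfolding fwd_diff_funpow using i3
    by (subst Bochner_Integration.integral_sum) (auto simp: sum_distrib_left)
  finally show "(\<integral>n. charlier lam m (real n) * F (real n) \<partial>?p)
       = lam ^ m * (\<integral>n. (fwd_diff ^^ m) F (real n) \<partial>?p)" .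
qed

lemma power_le_fact_exp:
  fixes x :: real
  assumes "x \<ge> 0"
  shows "x ^ k \<le> fact k * exp x"
proof -
  have "(\<Sum>n\<in>{k}. x ^ n /\<^sub>R fact n) \<le> (\<Sum>n. x ^ n /\<^sub>R fact n)"
    using assms summable_exp_generic[of x] by (intro sum_le_suminf) auto
  then show ?thesis by (simp add: exp_def field_simps)
qed

text \<open>Test functions of polynomial growth are always admissible: a polynomial is bounded by a multiple
  of \<open>exp n\<close>, and the Poisson distribution has a finite exponential moment.\<close>

lemma integrable_poisson_charlier_poly:
  fixes f :: "nat \<Rightarrow> real"
  assumes lam: "lam > 0" and f: "\<And>n. \<bar>f n\<bar> \<le> real n ^ r"
  shows "integrable (measure_pmf (poisson_pmf lam)) (\<lambda>n. charlier lam m (real n) * f n)"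
proof -
  let ?C = "fact (m + r) * exp lam * exp (- lam) :: real"
  have "\<bar>pmf (poisson_pmf lam) n * (charlier lam m (real n) * f n)\<bar> \<le> ?C * ((lam * exp 1) ^ n /\<^sub>R fact n)" for n
  proof -
    have "\<bar>charlier lam m (real n) * f n\<bar> \<le> (real n + lam) ^ m * (real n + lam) ^ r"
      unfolding abs_mult using lam
      by (intro mult_mono abs_charlier_le order_trans[OF f] power_mono) auto
    also have "\<dots> \<le> fact (m + r) * exp (real n + lam)"
      unfolding power_add[symmetric] using lam by (intro power_le_fact_exp) auto
    finally have "pmf (poisson_pmf lam) n * \<bar>charlier lam m (real n) * f n\<bar>
        \<le> pmf (poisson_pmf lam) n * (fact (m + r) * exp (real n + lam))"
      by (intro mult_left_mono) auto
    also have "exp (real n + lam) = exp 1 ^ n * exp lam"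
      by (simp add: exp_add exp_of_nat_mult[symmetric])
    finally show ?thesis
      using lam by (simp add: abs_mult power_mult_distrib field_simps)
  qed
  then show ?thesis
    unfolding integrable_pmf_nat
    by (intro summable_comparison_test[OF _ summable_mult[OF summable_exp_generic]]) auto
qed

section \<open>Antidifferences\<close>

text \<open>The line splits into the cosets \<open>x + \<int>\<close>, on each of which an antidifference is a running sum
  once its value at one point is chosen. Choosing \<open>0\<close> at the representative in \<open>[0, 1)\<close> gives
  the formula below. Working on the whole line is essential for uniqueness, where the other
  variable is not known to be integer valued.\<close>

lemma antidifference_exists:
  fixes g :: "real \<Rightarrow> real"
  obtains G where "fwd_diff G = g" "\<And>n. G (real n) = (\<Sum>i<n. g (real i))"
proof
  define G where "G x = (if x \<ge> 0 then \<Sum>i<nat \<lfloor>x\<rfloor>. g (frac x + real i)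
      else - (\<Sum>i<nat (- \<lfloor>x\<rfloor>). g (x + real i)))" for x
  show "G (real n) = (\<Sum>i<n. g (real i))" for n
    by (simp add: G_def frac_def)
  show "fwd_diff G = g"
  proof
    fix x :: real
    consider "x \<ge> 0" | "x < -1" | "-1 \<le> x" "x < 0" by linarith
    then show "fwd_diff G x = g x"
    proof cases
      case 1
      then have "nat \<lfloor>x + 1\<rfloor> = Suc (nat \<lfloor>x\<rfloor>)" "frac (x + 1) = frac x"
        by (simp_all add: frac_1_eq nat_add_distrib)
      moreover have "frac x + real (nat \<lfloor>x\<rfloor>) = x"
        using 1 by (simp add: frac_def)
      ultimately show ?thesis using 1 by (simp add: fwd_diff_def G_def)
    next
      case 2
      then have "nat (- \<lfloor>x\<rfloor>) = Suc (nat (- \<lfloor>x + 1\<rfloor>))" by linarith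
      then show ?thesis using 2
        by (simp add: fwd_diff_def G_def sum.lessThan_Suc_shift add_ac del: sum.lessThan_Suc)
    next
      case 3
      then have "\<lfloor>x\<rfloor> = -1" by linarith
      then show ?thesis using 3 by (simp add: fwd_diff_def G_def)
    qed
  qed
qed

lemma iterated_antidifference_exists:
  fixes g :: "real \<Rightarrow> real"
  assumes "\<And>n. \<bar>g (real n)\<bar> \<le> 1"
  shows "\<exists>F. (fwd_diff ^^ m) F = g \<and> (\<forall>n. \<bar>F (real n)\<bar> \<le> real n ^ m)"
proof (induction m)
  case 0
  then show ?case using assms by auto
next
  case (Suc m)
  then obtain F where F: "(fwd_diff ^^ m) F = g" "\<And>n. \<bar>F (real n)\<bar> \<le> real n ^ m" by auto
  obtain G where G: "fwd_diff G = F" "\<And>n. G (real n) = (\<Sum>i<n. F (real i))"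
    using antidifference_exists by blast
  have "\<bar>G (real n)\<bar> \<le> real n ^ Suc m" for n
  proof -
    have "\<bar>G (real n)\<bar> \<le> (\<Sum>i<n. real n ^ m)"
      unfolding G(2)
      by (intro order_trans[OF sum_abs] sum_mono order_trans[OF F(2)] power_mono) auto
    then show ?thesis by simp
  qed
  moreover have "(fwd_diff ^^ Suc m) G = g"
    by (simp add: funpow_Suc_right F G del: funpow.simps)
  ultimately show ?case by blast
qed

section \<open>The Poisson distribution as unique fixed point\<close>

theorem mainTheorem8:
  fixes lam :: real and m :: nat and M :: "'a measure" and Z :: "'a \<Rightarrow> nat"
  assumes "lam > 0"
    and "prob_space M"
    and "Z \<in> measurable M (count_space UNIV)"
    and "distr M (count_space UNIV) Z = measure_pmf (poisson_pmf lam)"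
  shows "(\<forall>F :: real \<Rightarrow> real.
            integrable M (\<lambda>\<omega>. charlier lam m (real (Z \<omega>)) * F (real (Z \<omega>))) \<longrightarrow>
            integrable M (\<lambda>\<omega>. (fwd_diff ^^ m) F (real (Z \<omega>))) \<and>
            (\<integral>\<omega>. charlier lam m (real (Z \<omega>)) * F (real (Z \<omega>)) \<partial>M)
              = lam ^ m * (\<integral>\<omega>. (fwd_diff ^^ m) F (real (Z \<omega>)) \<partial>M))
       \<and> discrete_biased M (\<lambda>\<omega>. real (Z \<omega>)) (charlier lam m) m M (\<lambda>\<omega>. real (Z \<omega>))
       \<and> (\<forall>(N :: 'b measure) Y.
            discrete_biased M (\<lambda>\<omega>. real (Z \<omega>)) (charlier lam m) m N Y \<longrightarrow>
            distr N borel Y = distr M borel (\<lambda>\<omega>. real (Z \<omega>)))"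
proof -
  note lam = assms(1) and Z = assms(3) and distrZ = assms(4)
  interpret prob_space M by fact
  let ?p = "measure_pmf (poisson_pmf lam)"
  have int_iff: "integrable M (\<lambda>\<omega>. f (Z \<omega>)) \<longleftrightarrow> integrable ?p f" for f :: "nat \<Rightarrow> real"
    using integrable_distr_eq[OF Z, of f] by (simp add: distrZ)
  have int_eq: "(\<integral>\<omega>. f (Z \<omega>) \<partial>M) = integral\<^sup>L ?p f" for f :: "nat \<Rightarrow> real"
    using integral_distr[OF Z, of f] by (simp add: distrZ)
  have Zreal [measurable]: "(\<lambda>\<omega>. real (Z \<omega>)) \<in> borel_measurable M"
    using Z by measurable
  have ident: "integrable M (\<lambda>\<omega>. (fwd_diff ^^ m) F (real (Z \<omega>)))"
    "(\<integral>\<omega>. charlier lam m (real (Z \<omega>)) * F (real (Z \<omega>)) \<partial>M)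
       = lam ^ m * (\<integral>\<omega>. (fwd_diff ^^ m) F (real (Z \<omega>)) \<partial>M)"
    if "integrable M (\<lambda>\<omega>. charlier lam m (real (Z \<omega>)) * F (real (Z \<omega>)))" for F
    using poisson_charlier[OF lam, of m F] that
      int_iff[of "\<lambda>n. charlier lam m (real n) * F (real n)"] int_iff[of "\<lambda>n. (fwd_diff ^^ m) F (real n)"]
      int_eq[of "\<lambda>n. charlier lam m (real n) * F (real n)"] int_eq[of "\<lambda>n. (fwd_diff ^^ m) F (real n)"]
    by auto
  have biased: "discrete_biased M (\<lambda>\<omega>. real (Z \<omega>)) (charlier lam m) m M (\<lambda>\<omega>. real (Z \<omega>))"
    unfolding discrete_biased_def using ident lam assms(2)
    by (auto intro!: exI[of _ "lam ^ m"])
  have unique: "distr N borel Y = distr M borel (\<lambda>\<omega>. real (Z \<omega>))"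
    if bias: "discrete_biased M (\<lambda>\<omega>. real (Z \<omega>)) (charlier lam m) m N Y"
    for N :: "'b measure" and Y
  proof -
    from bias obtain \<alpha> where N: "prob_space N" and Y [measurable]: "Y \<in> borel_measurable N"
      and \<alpha>: "\<alpha> > 0" "\<And>F. integrable M (\<lambda>\<omega>. charlier lam m (real (Z \<omega>)) * F (real (Z \<omega>))) \<Longrightarrow>
        (\<integral>\<omega>. charlier lam m (real (Z \<omega>)) * F (real (Z \<omega>)) \<partial>M) = \<alpha> * (\<integral>\<omega>. (fwd_diff ^^ m) F (Y \<omega>) \<partial>N)"
      unfolding discrete_biased_def by auto
    interpret N: prob_space N by fact
    have *: "lam ^ m * measure M {\<omega> \<in> space M. real (Z \<omega>) \<in> A} = \<alpha> * measure N {\<omega> \<in> space N. Y \<omega> \<in> A}"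
      if [measurable]: "A \<in> sets borel" for A
    proof -
      \<comment> \<open>An \<open>m\<close>-fold antidifference of the indicator of \<open>A\<close> turns the biasing identity into
          a statement about probabilities of \<open>A\<close>.\<close>
      obtain F where F: "(fwd_diff ^^ m) F = indicator A" "\<And>n. \<bar>F (real n)\<bar> \<le> real n ^ m"
        using iterated_antidifference_exists[of "indicator A" m] by (auto simp: indicator_def)
      have int: "integrable M (\<lambda>\<omega>. charlier lam m (real (Z \<omega>)) * F (real (Z \<omega>)))"
        using integrable_poisson_charlier_poly[OF lam F(2), of m]
          int_iff[of "\<lambda>n. charlier lam m (real n) * F (real n)"] by simp
      have "(\<integral>\<omega>. indicator A (real (Z \<omega>)) \<partial>M) = (\<integral>\<omega>. indicator {\<omega> \<in> space M. real (Z \<omega>) \<in> A} \<omega> \<partial>M :: real)"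
        by (intro Bochner_Integration.integral_cong) (auto simp: indicator_def)
      moreover have "(\<integral>\<omega>. indicator A (Y \<omega>) \<partial>N) = (\<integral>\<omega>. indicator {\<omega> \<in> space N. Y \<omega> \<in> A} \<omega> \<partial>N :: real)"
        by (intro Bochner_Integration.integral_cong) (auto simp: indicator_def)
      ultimately show ?thesis
        using ident(2)[OF int] \<alpha>(2)[OF int] by (simp add: F(1))
    qed
    \<comment> \<open>The normalising constant is forced by total mass one.\<close>
    have "\<alpha> = lam ^ m"
      using *[of UNIV] by (simp add: prob_space N.prob_space)
    with * lam have "measure M {\<omega> \<in> space M. real (Z \<omega>) \<in> A} = measure N {\<omega> \<in> space N. Y \<omega> \<in> A}"
      if "A \<in> sets borel" for A
      using that by simp
    then show ?thesis
      by (intro measure_eqI)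
         (auto simp: emeasure_distr vimage_def Int_def conj_commute emeasure_eq_measure N.emeasure_eq_measure)
  qed
  show ?thesis
    using ident biased unique by blast
qed

end
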